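(* Fix the dimension $d$ and constants $a_1,\ldots,a_d>0$, and let $c>\frac{d-1}{\sum_{i=1}^d a_i}$. If $p=p(n)\in[0,1]$ satisfies $p\ge\frac{c\log n}{n}$, then the random site subgraph of the Hamming torus is connected asymptotically almost surely as $n\to\infty$.
   Context: The $d$-dimensional Hamming torus (with parameters $a_1,\ldots,a_d>0$ and $n$) is the graph with vertex set $V=\{(x_1,\ldots,x_d)\in\mathbb{Z}^d: 1\le x_i\le a_i n,\ i=1,\ldots,d\}$ in which two vertices are adjacent exactly when they differ in exactly one coordinate (Hamming distance one). The random site subgraph with parameter $p$ is the induced subgraph obtained by independently keeping each vertex (calling it occupied) with probability $p$ and removing it, together with all incident edges, with probability $1-p$. "Asymptotically almost surely" means with probability tending to $1$ as $n\to\infty$, with $d,a_1,\ldots,a_d,c$ fixed. *)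

theory Defs
  imports "HOL-Probability.Probability" "Graph_Theory.Graph_Theory"
begin

hide_const (open) Topological_Spaces.connected

(* Points of Z^d are extensional functions on {1..d}. *)
definition torus_verts :: "nat \<Rightarrow> (nat \<Rightarrow> real) \<Rightarrow> nat \<Rightarrow> (nat \<Rightarrow> int) set" where
  "torus_verts d a n =
     (\<Pi>\<^sub>E i\<in>{1..d}. {k. 1 \<le> k \<and> real_of_int k \<le> a i * real n})"

definition hamming_dist :: "nat \<Rightarrow> (nat \<Rightarrow> int) \<Rightarrow> (nat \<Rightarrow> int) \<Rightarrow> nat" where
  "hamming_dist d x y = card {i \<in> {1..d}. x i \<noteq> y i}"

(* An undirected edge {x, y} is represented by the two arcs (x, y) and (y, x). *)
definition hamming_torus :: "nat \<Rightarrow> (nat \<Rightarrow> real) \<Rightarrow> nat \<Rightarrow> (nat \<Rightarrow> int) pair_pre_digraph" where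
  "hamming_torus d a n =
     \<lparr> pverts = torus_verts d a n,
       parcs = {(x, y). x \<in> torus_verts d a n \<and> y \<in> torus_verts d a n \<and> hamming_dist d x y = 1} \<rparr>"

lemma finite_torus_verts: "finite (torus_verts d a n)"
proof -
  have "finite {k::int. 1 \<le> k \<and> real_of_int k \<le> a i * real n}" for i
    by (rule finite_subset[of _ "{1..\<lfloor>a i * real n\<rfloor>}"]) (auto simp: le_floor_iff)
  then show ?thesis
    unfolding torus_verts_def by (intro finite_PiE) auto
qed

lemma hamming_dist_commute: "hamming_dist d x y = hamming_dist d y x"
  unfolding hamming_dist_def by (rule arg_cong[of _ _ card]) auto

lemma pair_graph_hamming_torus: "pair_graph (hamming_torus d a n)"
proof
  show "finite (pverts (hamming_torus d a n))"
    by (simp add: hamming_torus_def finite_torus_verts)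
  show "finite (parcs (hamming_torus d a n))"
    by (rule finite_subset[of _ "torus_verts d a n \<times> torus_verts d a n"])
       (auto simp: hamming_torus_def finite_torus_verts)
  show "symmetric (with_proj (hamming_torus d a n))"
    by (auto simp: symmetric_def sym_def hamming_torus_def hamming_dist_commute)
qed (auto simp: hamming_torus_def hamming_dist_def)

(* The law of the random induced subgraph. Pi_pmf is the product of the given
   laws only over a finite index set, so G must have finitely many vertices; the
   value False is assigned off the vertex set and plays no role. *)
definition site_subgraph :: "('v, 'e) pre_digraph \<Rightarrow> real \<Rightarrow> ('v, 'e) pre_digraph pmf" where
  "site_subgraph G p =
     map_pmf (\<lambda>occupied. G \<restriction> {v \<in> verts G. occupied v})
       (Pi_pmf (verts G) False (\<lambda>_. bernoulli_pmf p))"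

end

theory Submission
  imports Defs
begin

text \<open>
  Suppose that the occupied set is nonempty and disconnected. Call a vertex full for a component
  if all d lines through it meet the component. Distinct components meet disjoint sets of lines, so
  some component W has at most half of all vertices full. Inside W there is a connected set T that
  meets the same lines and has at most as many vertices as lines. Every vertex on one of these
  lines that is not full is vacant; these vertices form the boundary of T.

  The expected number of such T is bounded by summing \<open>p\<^sup>t (1 - p)\<^sup>b\<close> over
  connected T, where t is the size of T and b that of its boundary. There are at most
  \<open>N D\<^sup>t\<^sup>-\<^sup>1\<close> such T up to a factor exponential in t, with N vertices and
  degrees of order D, a multiple of n. An isoperimetric inequality gives \<open>b \<ge> \<kappa> t n\<close>,
  which handles all t above a constant. For bounded t one has
  \<open>b \<ge> (a\<^sub>1 + ... + a\<^sub>d) n - O(1)\<close>, and here the hypothesis on c makes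
  \<open>n\<^sup>d\<^sup>-\<^sup>1 exp (- p b)\<close> tend to 0.
\<close>

section \<open>Connected sets in site percolation\<close>

text \<open>Connectivity of the subgraph induced on \<open>T\<close>, in cut form: for symmetric
  \<open>E\<close> it agrees with the path form, and no paths have to be built. The empty set
  satisfies it vacuously.\<close>

definition conn_set :: "('v \<Rightarrow> 'v \<Rightarrow> bool) \<Rightarrow> 'v set \<Rightarrow> bool" where
  "conn_set E T \<longleftrightarrow> (\<forall>U. U \<subset> T \<and> U \<noteq> {} \<longrightarrow> (\<exists>u\<in>U. \<exists>w\<in>T - U. E u w))"

lemma conn_setD:
  "conn_set E T \<Longrightarrow> U \<subset> T \<Longrightarrow> U \<noteq> {} \<Longrightarrow> \<exists>u\<in>U. \<exists>w\<in>T - U. E u w"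
  by (auto simp: conn_set_def)

lemma conn_set_singleton: "conn_set E {x}"
  by (auto simp: conn_set_def)

text \<open>A cut of the enlarged set either already cuts \<open>T\<close> or separates
  \<open>w\<close> from all of \<open>T\<close>. In the second case \<open>w\<close> may lie on
  either side, which accounts for the two arc assumptions.\<close>

lemma conn_set_insert:
  assumes "conn_set E T" "t \<in> T" "E t w" "E w t"
  shows "conn_set E (insert w T)"
  unfolding conn_set_def
proof (intro allI impI)
  fix U assume U: "U \<subset> insert w T \<and> U \<noteq> {}"
  consider "U \<inter> T = {}" | "U \<inter> T = T" | "U \<inter> T \<subset> T" "U \<inter> T \<noteq> {}" by blast
  then show "\<exists>u\<in>U. \<exists>v\<in>insert w T - U. E u v"
  proof cases
    case 1
    then have "U = {w}" "w \<notin> T" using U by auto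
    then show ?thesis using assms by auto
  next
    case 2
    then have "w \<notin> U" "t \<in> U" using U assms by auto
    then show ?thesis using assms by auto
  next
    case 3
    from conn_setD[OF assms(1) this] show ?thesis by blast
  qed
qed

text \<open>Both sets are the cluster of \<open>x\<close> in the configuration \<open>f\<close>. If
  one were not contained in the other, its connectivity would give an arc leaving the intersection,
  whose endpoint is occupied as a member of one set and vacant as a neighbour of the other.\<close>

lemma conn_set_unique:
  assumes "conn_set E T" "conn_set E T'" "x \<in> T" "x \<in> T'" "T \<subseteq> V" "T' \<subseteq> V"
    and "\<forall>v\<in>T. f v" "\<forall>w\<in>{w \<in> V - T. \<exists>u\<in>T. E u w}. \<not> f w"
    and "\<forall>v\<in>T'. f v" "\<forall>w\<in>{w \<in> V - T'. \<exists>u\<in>T'. E u w}. \<not> f w"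
  shows "T = T'"
proof -
  have "T' \<subseteq> T"
  proof (rule ccontr)
    assume "\<not> T' \<subseteq> T"
    then have "\<exists>u\<in>T' \<inter> T. \<exists>w\<in>T' - T' \<inter> T. E u w"
      using assms by (intro conn_setD) auto
    with assms show False by blast
  qed
  moreover have "T \<subseteq> T'"
  proof (rule ccontr)
    assume "\<not> T \<subseteq> T'"
    then have "\<exists>u\<in>T \<inter> T'. \<exists>w\<in>T - T \<inter> T'. E u w"
      using assms by (intro conn_setD) auto
    with assms show False by blast
  qed
  ultimately show ?thesis by blast
qed

abbreviation site_pmf :: "'v set \<Rightarrow> real \<Rightarrow> ('v \<Rightarrow> bool) pmf" where
  "site_pmf V q \<equiv> Pi_pmf V False (\<lambda>_. bernoulli_pmf q)"

text \<open>The event constrains each site separately, so it is a product set and its probability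
  factorizes.\<close>

lemma prob_occupied_vacant:
  assumes "finite V" "S \<subseteq> V" "R \<subseteq> V" "S \<inter> R = {}" "0 \<le> q" "q \<le> 1"
  shows "measure_pmf.prob (site_pmf V q) {f. (\<forall>v\<in>S. f v) \<and> (\<forall>v\<in>R. \<not> f v)}
           = q ^ card S * (1 - q) ^ card R"
proof -
  define B where "B = (\<lambda>v. if v \<in> S then {True} else if v \<in> R then {False} else UNIV)"
  have fin: "finite S" "finite R" using assms by (auto intro: finite_subset)
  have "{f. (\<forall>v\<in>S. f v) \<and> (\<forall>v\<in>R. \<not> f v)} = Pi V B"
    using assms by (auto simp: B_def Pi_def split: if_splits)
  then have "measure_pmf.prob (site_pmf V q) {f. (\<forall>v\<in>S. f v) \<and> (\<forall>v\<in>R. \<not> f v)}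
      = (\<Prod>v\<in>V. measure_pmf.prob (bernoulli_pmf q) (B v))"
    using measure_Pi_pmf_Pi[OF assms(1)] by simp
  also have "\<dots> = (\<Prod>v\<in>V. (if v \<in> S then q else 1) * (if v \<in> R then 1 - q else 1))"
    using assms by (intro prod.cong) (auto simp: B_def measure_pmf_single)
  also have "\<dots> = q ^ card S * (1 - q) ^ card R"
    using assms fin
    by (simp add: prod.distrib prod.If_cases Int_absorb1)
  finally show ?thesis .
qed

text \<open>For fixed x, the events ``the cluster of x is T'' are disjoint and force x to be occupied.\<close>

lemma sum_conn_sets_le:
  fixes q :: real
  assumes "finite V" "x \<in> V" "0 \<le> q" "q \<le> 1"
  shows "(\<Sum>T\<in>{T. T \<subseteq> V \<and> x \<in> T \<and> conn_set E T}.
            q ^ card T * (1 - q) ^ card {w \<in> V - T. \<exists>u\<in>T. E u w}) \<le> q"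
proof -
  define Q where "Q = {T. T \<subseteq> V \<and> x \<in> T \<and> conn_set E T}"
  define bd where "bd T = {w \<in> V - T. \<exists>u\<in>T. E u w}" for T
  define ev where "ev T = {f. (\<forall>v\<in>T. f v) \<and> (\<forall>v\<in>bd T. \<not> f v)}" for T
  let ?P = "measure_pmf.prob (site_pmf V q)"
  have finQ: "finite Q" unfolding Q_def
    by (rule finite_subset[of _ "Pow V"]) (use assms in auto)
  have "(\<Sum>T\<in>Q. q ^ card T * (1 - q) ^ card (bd T)) = (\<Sum>T\<in>Q. ?P (ev T))"
    unfolding ev_def
    by (intro sum.cong refl prob_occupied_vacant[symmetric])
       (use assms in \<open>auto simp: Q_def bd_def\<close>)
  also have "\<dots> = ?P (\<Union>T\<in>Q. ev T)"
  proof (rule measure_pmf.finite_measure_finite_Union[symmetric, OF finQ])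
    show "disjoint_family_on ev Q"
      unfolding disjoint_family_on_def
    proof (intro ballI impI)
      fix T T' assume T: "T \<in> Q" "T' \<in> Q" "T \<noteq> T'"
      have False if "f \<in> ev T" "f \<in> ev T'" for f
        using conn_set_unique[of E T T' x V f] T that
        by (auto simp: Q_def ev_def bd_def)
      then show "ev T \<inter> ev T' = {}" by blast
    qed
  qed auto
  also have "\<dots> \<le> ?P {f. (\<forall>v\<in>{x}. f v) \<and> (\<forall>v\<in>{}. \<not> f v)}"
    by (rule measure_pmf.finite_measure_mono) (auto simp: Q_def ev_def)
  also have "\<dots> = q"
    using assms by (subst prob_occupied_vacant) auto
  finally show ?thesis by (simp add: Q_def bd_def)
qed

text \<open>Counting by an auxiliary percolation with \<open>q = 1 / (D + 1)\<close>: a set of size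
  \<open>t\<close> has at most \<open>D * t\<close> outer neighbours, so its weight in
  \<open>sum_conn_sets_le\<close> is at least \<open>q ^ t * exp (- t)\<close>, while all weights
  together are at most \<open>q\<close>.\<close>

lemma card_conn_sets_le:
  assumes "finite V" "x \<in> V" "t \<ge> 1"
    and deg: "\<And>v. v \<in> V \<Longrightarrow> card {w \<in> V. E v w} \<le> D"
  shows "real (card {T. T \<subseteq> V \<and> x \<in> T \<and> conn_set E T \<and> card T = t})
           \<le> (real D + 1) ^ (t - 1) * exp (real t)"
proof -
  define q where "q = 1 / (real D + 1)"
  have q: "0 < q" "q \<le> 1" by (auto simp: q_def)
  define Q where "Q = {T. T \<subseteq> V \<and> x \<in> T \<and> conn_set E T}"
  define Qt where "Qt = {T. T \<subseteq> V \<and> x \<in> T \<and> conn_set E T \<and> card T = t}"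
  define bd where "bd T = {w \<in> V - T. \<exists>u\<in>T. E u w}" for T
  have finQ: "finite Q" unfolding Q_def
    by (rule finite_subset[of _ "Pow V"]) (use assms in auto)
  have sub: "Qt \<subseteq> Q" by (auto simp: Q_def Qt_def)
  have exp_le: "exp (- 1) \<le> (1 - q) ^ D"
  proof (cases "D = 0")
    case False
    \<comment> \<open>Here \<open>1 - q\<close> is the reciprocal of \<open>1 + 1 / D\<close>, whose
      \<open>D\<close>-th power is at most \<open>exp 1\<close>.\<close>
    then have "1 - q = inverse (1 + 1 / real D)" by (simp add: q_def field_simps)
    moreover have "(1 + 1 / real D) ^ D \<le> exp 1"
      using exp_ge_one_plus_x_over_n_power_n[of D 1] False by simp
    moreover have "(1 + 1 / real D) ^ D > 0" by (intro zero_less_power add_pos_nonneg) auto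
    ultimately show ?thesis
      by (simp add: power_inverse exp_minus le_imp_inverse_le del: inverse_eq_divide)
  qed auto
  have key: "q ^ t * exp (- real t) \<le> q ^ card T * (1 - q) ^ card (bd T)" if "T \<in> Qt" for T
  proof -
    have T: "T \<subseteq> V" "card T = t" using that by (auto simp: Qt_def)
    have finT: "finite T" using T assms finite_subset by auto
    have "card (bd T) \<le> card (\<Union>v\<in>T. {w \<in> V. E v w})"
      by (intro card_mono finite_UN_I finT) (use assms in \<open>auto simp: bd_def\<close>)
    also have "\<dots> \<le> (\<Sum>v\<in>T. card {w \<in> V. E v w})" by (rule card_UN_le[OF finT])
    also have "\<dots> \<le> (\<Sum>v\<in>T. D)" by (intro sum_mono deg) (use T in auto)
    finally have *: "card (bd T) \<le> D * t" using T by (simp add: mult.commute)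
    have "exp (- real t) = exp (- 1) ^ t" by (simp add: exp_of_nat_mult[symmetric])
    also have "\<dots> \<le> ((1 - q) ^ D) ^ t" by (intro power_mono exp_le) auto
    also have "\<dots> = (1 - q) ^ (D * t)" by (simp add: power_mult)
    also have "\<dots> \<le> (1 - q) ^ card (bd T)" by (intro power_decreasing *) (use q in auto)
    finally show ?thesis using T q by (intro mult_mono) auto
  qed
  have "real (card Qt) * (q ^ t * exp (- real t)) \<le> (\<Sum>T\<in>Qt. q ^ card T * (1 - q) ^ card (bd T))"
    using sum_mono[OF key, of Qt "\<lambda>T. T"] by simp
  also have "\<dots> \<le> (\<Sum>T\<in>Q. q ^ card T * (1 - q) ^ card (bd T))"
    by (intro sum_mono2 finQ sub) (use q in auto)
  also have "\<dots> \<le> q"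
    using sum_conn_sets_le[of V x q E] assms q by (simp add: Q_def bd_def)
  finally have "real (card Qt) * (q ^ t * exp (- real t)) \<le> q" .
  \<comment> \<open>One factor \<open>q\<close> cancels against the right-hand side; this yields the
    exponent \<open>t - 1\<close> and saves a factor of order \<open>D\<close> in the count.\<close>
  moreover have "q ^ t = q * q ^ (t - 1)" using assms by (cases t) auto
  ultimately have "real (card Qt) * (q ^ (t - 1) * exp (- real t)) \<le> 1"
    using q by (simp add: mult.left_commute)
  then show ?thesis
    by (simp add: Qt_def[symmetric] q_def power_divide exp_minus field_simps)
qed

lemma power_one_minus_le_exp:
  fixes q :: real
  assumes "q \<le> 1"
  shows "(1 - q) ^ k \<le> exp (- q * real k)"
proof -
  have "(1 - q) ^ k \<le> exp (- q) ^ k"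
    using assms exp_ge_add_one_self[of "- q"] by (intro power_mono) auto
  then show ?thesis by (simp add: exp_of_nat2_mult[symmetric])
qed

section \<open>Lines in a box\<close>

locale box =
  fixes d :: nat and K :: "nat \<Rightarrow> int set"
  assumes d_pos: "d \<ge> 1" and finite_K: "\<And>i. i \<in> {1..d} \<Longrightarrow> finite (K i)"
begin

definition V :: "(nat \<Rightarrow> int) set" where "V = PiE {1..d} K"

text \<open>Distinct points on a common line, in the encoding used for \<open>lines\<close>. The
  entry 0 only erases a coordinate: the label \<open>x(i := 0)\<close> of a line need not be a
  vertex.\<close>

definition adj :: "(nat \<Rightarrow> int) \<Rightarrow> (nat \<Rightarrow> int) \<Rightarrow> bool" where
  "adj x y \<longleftrightarrow> x \<noteq> y \<and> (\<exists>i\<in>{1..d}. x(i := 0) = y(i := 0))"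

text \<open>The line through x in direction i is encoded as (i, x(i := 0)).\<close>

definition lines :: "(nat \<Rightarrow> int) set \<Rightarrow> (nat \<times> (nat \<Rightarrow> int)) set" where
  "lines T = (\<lambda>(i, x). (i, x(i := 0))) ` ({1..d} \<times> T)"

definition covered :: "(nat \<times> (nat \<Rightarrow> int)) set \<Rightarrow> (nat \<Rightarrow> int) set" where
  "covered L = {y \<in> V. \<exists>i\<in>{1..d}. (i, y(i := 0)) \<in> L}"

definition full :: "(nat \<times> (nat \<Rightarrow> int)) set \<Rightarrow> (nat \<Rightarrow> int) set" where
  "full L = {y \<in> V. \<forall>i\<in>{1..d}. (i, y(i := 0)) \<in> L}"

text \<open>The bound on \<open>card T\<close> keeps the number of candidates in the union bound small
  relative to the boundary, which is linear in \<open>card (lines T)\<close>.\<close>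

definition isolating :: "(nat \<Rightarrow> int) set \<Rightarrow> bool" where
  "isolating T \<longleftrightarrow> T \<subseteq> V \<and> T \<noteq> {} \<and> conn_set adj T \<and> card T \<le> card (lines T)
     \<and> 2 * card (full (lines T)) \<le> card V"

text \<open>Full vertices are removed because they may be occupied members of the component from
  which \<open>T\<close> was extracted.\<close>

definition boundary :: "(nat \<Rightarrow> int) set \<Rightarrow> (nat \<Rightarrow> int) set" where
  "boundary T = covered (lines T) - full (lines T)"

lemma finite_V: "finite V"
  unfolding V_def using finite_K by (intro finite_PiE) auto

lemma in_lines_iff: "(i, z) \<in> lines T \<longleftrightarrow> i \<in> {1..d} \<and> (\<exists>x\<in>T. z = x(i := 0))"
  by (auto simp: lines_def)

lemma finite_lines: "finite T \<Longrightarrow> finite (lines T)"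
  by (auto simp: lines_def)

lemma adj_sym: "adj x y \<longleftrightarrow> adj y x"
  unfolding adj_def by metis

lemma subset_full: "T \<subseteq> V \<Longrightarrow> T \<subseteq> full (lines T)"
  by (auto simp: full_def in_lines_iff)

lemma full_subset_covered: "full L \<subseteq> covered L"
  using d_pos by (auto simp: full_def covered_def)

lemma finite_full: "finite (full L)" and finite_covered: "finite (covered L)"
  using finite_V by (auto simp: full_def covered_def)

lemma fun_upd_zero_eqD: "x(i := 0) = y(i := 0) \<Longrightarrow> j \<noteq> i \<Longrightarrow> x j = (y j :: int)"
  by (metis fun_upd_other)

lemma fun_upd_in_V: "x \<in> V \<Longrightarrow> i \<in> {1..d} \<Longrightarrow> k \<in> K i \<Longrightarrow> x(i := k) \<in> V"
  by (auto simp: V_def PiE_def extensional_def)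

lemma degree_le:
  assumes "x \<in> V"
  shows "card {y \<in> V. adj x y} \<le> (\<Sum>i=1..d. card (K i))"
proof -
  have "{y \<in> V. adj x y} \<subseteq> (\<lambda>(i, k). x(i := k)) ` Sigma {1..d} K"
  proof
    fix y assume y: "y \<in> {y \<in> V. adj x y}"
    then obtain i where i: "i \<in> {1..d}" "x(i := 0) = y(i := 0)" by (auto simp: adj_def)
    then have "y = x(i := y i)" by (metis fun_upd_triv fun_upd_upd)
    moreover have "y i \<in> K i" using y i by (auto simp: V_def)
    ultimately show "y \<in> (\<lambda>(i, k). x(i := k)) ` Sigma {1..d} K"
      using i by (intro image_eqI[of _ _ "(i, y i)"]) auto
  qed
  then have "card {y \<in> V. adj x y} \<le> card (Sigma {1..d} K)"
    using finite_K by (intro surj_card_le) auto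
  also have "\<dots> = (\<Sum>i=1..d. card (K i))" using finite_K by simp
  finally show ?thesis .
qed

text \<open>Walk from \<open>f \<in> F\<close> to \<open>y \<notin> F\<close> by changing coordinates 1, 2, ... in turn. The first
  vertex outside F, together with the walk's complementary coordinates, determines f and y.\<close>

lemma isoperimetric:
  assumes "F \<subseteq> V" "2 * card F \<le> card V" "finite B"
    and B: "\<And>f y i. f \<in> F \<Longrightarrow> y \<in> V - F \<Longrightarrow> i \<in> {1..d} \<Longrightarrow> f(i := 0) = y(i := 0) \<Longrightarrow> y \<in> B"
  shows "card F \<le> 2 * d * card B"
proof (cases "F = {}")
  case False
  have finF: "finite F" using assms finite_V by (auto intro: finite_subset)
  have mixV: "(\<lambda>j. if j \<le> i then y j else f j) \<in> V" if "y \<in> V" "f \<in> V" for f y and i :: nat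
    using that by (auto simp: V_def PiE_def extensional_def Pi_def)
  define h where "h f y i = (\<lambda>j. if j \<le> i then y j else f j)" for f y :: "nat \<Rightarrow> int" and i :: nat
  define k where "k f y = (LEAST i. h f y i \<notin> F)" for f y
  define \<phi> where "\<phi> = (\<lambda>(f, y). (k f y, h f y (k f y), h y f (k f y)))"
  have k: "k f y \<in> {1..d} \<and> h f y (k f y) \<in> B" if "f \<in> F" "y \<in> V - F" for f y
  proof -
    have fV: "f \<in> V" using that assms by auto
    have "h f y d = y" using fV that
      by (auto simp: h_def V_def fun_eq_iff PiE_def extensional_def)
    then have ex: "h f y d \<notin> F" using that by auto
    then have "k f y \<le> d" unfolding k_def by (rule Least_le)
    moreover have notF: "h f y (k f y) \<notin> F" unfolding k_def using ex by (rule LeastI)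
    moreover have "h f y 0 = f" using fV that
      by (auto simp: h_def V_def fun_eq_iff PiE_def extensional_def)
    ultimately have kd: "k f y \<in> {1..d}" using that(1) by (cases "k f y") auto
    \<comment> \<open>The last vertex before the exit is in \<open>F\<close> and differs from the
      exit vertex at most in coordinate \<open>k f y\<close>, so the hypothesis on \<open>B\<close>
      applies to this pair.\<close>
    have "h f y (k f y - 1) \<in> F"
      using not_less_Least[of "k f y - 1" "\<lambda>i. h f y i \<notin> F"] kd by (auto simp: k_def)
    moreover have "(h f y (k f y - 1))(k f y := 0) = (h f y (k f y))(k f y := 0)"
      using kd by (auto simp: h_def fun_eq_iff)
    moreover have "h f y (k f y) \<in> V - F" using mixV[of y f] fV that notF by (auto simp: h_def)
    ultimately show ?thesis using B kd by blast
  qed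
  have "inj_on \<phi> (F \<times> (V - F))"
  proof (rule inj_onI, clarify)
    fix f y f' y' assume eq: "\<phi> (f, y) = \<phi> (f', y')"
    have kk: "k f y = k f' y'" using eq by (simp add: \<phi>_def)
    have h1: "h f y (k f y) = h f' y' (k f y)" and h2: "h y f (k f y) = h y' f' (k f y)"
      using eq kk by (auto simp: \<phi>_def)
    have "f j = f' j \<and> y j = y' j" for j
      using fun_cong[OF h1, of j] fun_cong[OF h2, of j] by (auto simp: h_def split: if_splits)
    then show "f = f' \<and> y = y'" by (auto simp: fun_eq_iff)
  qed
  moreover have "\<phi> ` (F \<times> (V - F)) \<subseteq> {1..d} \<times> (B \<times> V)"
  proof (rule image_subsetI, clarify)
    fix f y assume fy: "f \<in> F" "y \<in> V" "y \<notin> F"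
    then have "h y f (k f y) \<in> V" using mixV[of f y] assms by (auto simp: h_def)
    then show "\<phi> (f, y) \<in> {1..d} \<times> (B \<times> V)" using k[of f y] fy by (auto simp: \<phi>_def)
  qed
  ultimately have "card (F \<times> (V - F)) \<le> card ({1..d} \<times> (B \<times> V))"
    using finite_V assms by (intro card_inj_on_le) auto
  then have "card F * (card V - card F) \<le> d * card B * card V"
    using assms finF by (simp add: card_cartesian_product card_Diff_subset)
  \<comment> \<open>As \<open>F\<close> fills at most half of \<open>V\<close>,
    \<open>card V\<close> is at most twice the size of the complement.\<close>
  moreover have "card F * card V \<le> card F * (2 * (card V - card F))"
    using assms(2) by (intro mult_left_mono) auto
  ultimately have "card F * card V \<le> 2 * d * card B * card V" by linarith
  moreover have "card V > 0" using False assms(1) finite_V by (auto simp: card_gt_0_iff)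
  ultimately show ?thesis by simp
qed auto

text \<open>Double counting of incidences: each line carries at least \<open>m\<close> vertices, and
  each covered vertex lies on at most \<open>d\<close> lines.\<close>

lemma card_lines_le_covered:
  assumes "T \<subseteq> V" and m: "\<And>i. i \<in> {1..d} \<Longrightarrow> m \<le> card (K i)"
  shows "card (lines T) * m \<le> d * card (covered (lines T))"
proof -
  define P where "P l = {y \<in> V. y(fst l := 0) = snd l}" for l :: "nat \<times> (nat \<Rightarrow> int)"
  have finT: "finite T" using assms finite_V by (auto intro: finite_subset)
  have finP: "finite (P l)" for l using finite_V by (auto simp: P_def)
  have m_le: "m \<le> card (P l)" if "l \<in> lines T" for l
  proof -
    obtain i x where l: "l = (i, x(i := 0))" "i \<in> {1..d}" "x \<in> T"
      using \<open>l \<in> lines T\<close> by (auto simp: lines_def)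
    have "card (K i) \<le> card (P l)"
    proof (rule card_inj_on_le[OF _ _ finP])
      show "inj_on (\<lambda>k. x(i := k)) (K i)" by (auto simp: inj_on_def dest: fun_cong[of _ _ i])
      show "(\<lambda>k. x(i := k)) ` K i \<subseteq> P l"
        using l assms fun_upd_in_V by (auto simp: P_def)
    qed
    then show ?thesis using m l by force
  qed
  have "card (lines T) * m = (\<Sum>l\<in>lines T. m)" by simp
  also have "\<dots> \<le> (\<Sum>l\<in>lines T. card (P l))" by (intro sum_mono m_le)
  also have "\<dots> = card (Sigma (lines T) P)" using finite_lines[OF finT] finP by simp
  also have "\<dots> \<le> card ({1..d} \<times> covered (lines T))"
  \<comment> \<open>A vertex and a direction determine the line, so only the direction of
    \<open>l\<close> has to be kept.\<close>
  proof (rule card_inj_on_le[of "\<lambda>(l, y). (fst l, y)"])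
    show "inj_on (\<lambda>(l, y). (fst l, y)) (Sigma (lines T) P)"
      by (auto simp: inj_on_def P_def)
    show "(\<lambda>(l, y). (fst l, y)) ` Sigma (lines T) P \<subseteq> {1..d} \<times> covered (lines T)"
    proof (rule image_subsetI, clarsimp simp del: atLeastAtMost_iff One_nat_def)
      fix i z y assume *: "(i, z) \<in> lines T" "y \<in> P (i, z)"
      then have "(i, y(i := 0)) \<in> lines T" "y \<in> V" by (auto simp: P_def)
      moreover have "i \<in> {1..d}" using * by (simp add: in_lines_iff)
      ultimately show "i \<in> {1..d} \<and> y \<in> covered (lines T)"
        unfolding covered_def by auto
    qed
  qed (use finite_covered in auto)
  also have "\<dots> = d * card (covered (lines T))" by (simp add: card_cartesian_product)
  finally show ?thesis .
qed

section \<open>Lower bounds for the boundary\<close>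

lemma card_boundary:
  "card (boundary T) = card (covered (lines T)) - card (full (lines T))"
  "card (full (lines T)) \<le> card (covered (lines T))"
  unfolding boundary_def
  using full_subset_covered finite_full finite_covered by (auto simp: card_Diff_subset card_mono)

text \<open>A vertex that is not full but shares a line with a full vertex is covered, hence in the
  boundary. So \<open>isoperimetric\<close> bounds the full vertices, and then all covered vertices,
  by a multiple of the boundary; \<open>card_lines_le_covered\<close> and
  \<open>card T \<le> card (lines T)\<close> bring in \<open>card T\<close>.\<close>

lemma boundary_linear:
  assumes "isolating T" and m: "\<And>i. i \<in> {1..d} \<Longrightarrow> m \<le> card (K i)"
  shows "card T * m \<le> d * (2 * d + 1) * card (boundary T)"
proof -
  have T: "T \<subseteq> V" "card T \<le> card (lines T)" "2 * card (full (lines T)) \<le> card V"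
    using assms by (auto simp: isolating_def)
  have "card (full (lines T)) \<le> 2 * d * card (boundary T)"
  proof (rule isoperimetric)
    show "finite (boundary T)" using finite_covered by (simp add: boundary_def)
    fix f y i
    assume *: "f \<in> full (lines T)" "y \<in> V - full (lines T)" "i \<in> {1..d}" "f(i := 0) = y(i := 0)"
    then have "(i, y(i := 0)) \<in> lines T" by (auto simp: full_def dest!: bspec[of _ _ i])
    then show "y \<in> boundary T" using * unfolding boundary_def covered_def by blast
  qed (use T in \<open>auto simp: full_def\<close>)
  then have "card (covered (lines T)) \<le> (2 * d + 1) * card (boundary T)"
    using card_boundary[of T] by simp
  then have "d * card (covered (lines T)) \<le> d * ((2 * d + 1) * card (boundary T))"
    by (intro mult_left_mono) auto
  moreover have "card T * m \<le> card (lines T) * m" using T by (intro mult_right_mono) auto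
  ultimately show ?thesis
    using card_lines_le_covered[OF T(1) assms(2)] unfolding mult.assoc by linarith
qed

text \<open>The lines through a single point of \<open>T\<close> already cover almost
  \<open>(\<Sum>i=1..d. card (K i))\<close> vertices, and few vertices are full: a full vertex is
  determined by one point of \<open>T\<close> on its line in direction 1 and one in direction 2. For
  bounded \<open>T\<close> the loss is therefore a constant.\<close>

lemma boundary_sharp:
  assumes T: "T \<subseteq> V" "T \<noteq> {}" and "d \<ge> 2"
  shows "(\<Sum>i=1..d. card (K i)) \<le> card (boundary T) + d + card T ^ 2"
proof -
  have finT: "finite T" using assms finite_V by (auto intro: finite_subset)
  have "card (full (lines T)) \<le> card (T \<times> T)"
  proof (rule card_inj_on_le)
    define g where "g i y = (SOME x. x \<in> T \<and> y(i := 0) = x(i := 0))" for i and y :: "nat \<Rightarrow> int"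
    have g: "g i y \<in> T \<and> y(i := 0) = (g i y)(i := 0)" if "y \<in> full (lines T)" "i \<in> {1..d}" for i y
    proof -
      have "\<exists>x. x \<in> T \<and> y(i := 0) = x(i := 0)"
        using that unfolding full_def in_lines_iff by blast
      from someI_ex[OF this] show ?thesis unfolding g_def .
    qed
    show "(\<lambda>y. (g 1 y, g 2 y)) ` full (lines T) \<subseteq> T \<times> T" using g assms by auto
    show "inj_on (\<lambda>y. (g 1 y, g 2 y)) (full (lines T))"
    proof (rule inj_onI, rule ext)
      fix y z j assume yz: "y \<in> full (lines T)" "z \<in> full (lines T)" "(g 1 y, g 2 y) = (g 1 z, g 2 z)"
      have "1 \<in> {1..d}" "2 \<in> {1..d}" using assms by auto
      \<comment> \<open>The first equation fixes every coordinate except 1, the second every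
        coordinate except 2.\<close>
      then have "y(1 := 0) = z(1 := 0)" "y(2 := 0) = z(2 := 0)"
        using g yz by (metis prod.inject)+
      then show "y j = z j" using fun_upd_zero_eqD[of y 1 z j] fun_upd_zero_eqD[of y 2 z j]
        by (cases "j = 1") auto
    qed
  qed (use finT in auto)
  then have 1: "card (full (lines T)) \<le> card T ^ 2"
    by (simp add: card_cartesian_product power2_eq_square)
  obtain x where x: "x \<in> T" using T by auto
  then have xK: "x i \<in> K i" if "i \<in> {1..d}" for i
    using T(1) that unfolding V_def by (meson PiE_mem subsetD)
  \<comment> \<open>The point \<open>x\<close> lies on all of these lines and is left out, which
    makes the parametrization injective and costs the summand \<open>d\<close>.\<close>
  have "card (Sigma {1..d} (\<lambda>i. K i - {x i})) \<le> card (covered (lines T))"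
  proof (rule card_inj_on_le[OF _ _ finite_covered])
    show "inj_on (\<lambda>(i, k). x(i := k)) (Sigma {1..d} (\<lambda>i. K i - {x i}))"
    proof (rule inj_onI)
      fix s s' assume s: "s \<in> Sigma {1..d} (\<lambda>i. K i - {x i})" "s' \<in> Sigma {1..d} (\<lambda>i. K i - {x i})"
        and eq: "(\<lambda>(i, k). x(i := k)) s = (\<lambda>(i, k). x(i := k)) s'"
      obtain i k i' k' where ik: "s = (i, k)" "s' = (i', k')" by (cases s, cases s')
      have eq': "x(i := k) = x(i' := k')" and "k \<noteq> x i" using eq s ik by auto
      then have "i = i'" by (metis fun_upd_same fun_upd_other)
      then show "s = s'" using fun_cong[OF eq', of i] ik by simp
    qed
    show "(\<lambda>(i, k). x(i := k)) ` Sigma {1..d} (\<lambda>i. K i - {x i}) \<subseteq> covered (lines T)"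
    proof (rule image_subsetI)
      fix s assume s: "s \<in> Sigma {1..d} (\<lambda>i. K i - {x i})"
      obtain i k where ik: "s = (i, k)" by (cases s)
      have k: "i \<in> {1..d}" "k \<in> K i" using s ik by auto
      have "(i, (x(i := k))(i := 0)) \<in> lines T" using x k by (auto simp: in_lines_iff)
      moreover have "x(i := k) \<in> V" using x T k fun_upd_in_V by auto
      ultimately show "(\<lambda>(i, k). x(i := k)) s \<in> covered (lines T)"
        using k unfolding covered_def ik prod.case by blast
    qed
  qed
  moreover have "(\<Sum>i=1..d. card (K i)) = (\<Sum>i=1..d. card (K i - {x i}) + 1)"
    using xK finite_K by (intro sum.cong refl) (metis Suc_eq_plus1 card_Suc_Diff1)
  moreover have "\<dots> = card (Sigma {1..d} (\<lambda>i. K i - {x i})) + d"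
    using finite_K by (subst sum.distrib) simp
  ultimately have 2: "(\<Sum>i=1..d. card (K i)) \<le> card (covered (lines T)) + d"
    by linarith
  show ?thesis using 1 2 card_boundary[of T] by linarith
qed

text \<open>In dimension one \<open>V\<close> lies on a single line, so a nonempty \<open>T\<close>
  makes every vertex full, against the half bound. This disposes of the case excluded in
  \<open>boundary_sharp\<close>.\<close>

lemma not_isolating_dim1:
  assumes "d = 1"
  shows "\<not> isolating T"
proof
  assume T: "isolating T"
  then obtain x where x: "x \<in> T" "x \<in> V" by (auto simp: isolating_def)
  have "full (lines T) = V"
  proof -
    have *: "y(1 := 0) = x(1 := 0)" if "y \<in> V" for y
    proof
      fix j show "(y(1 := 0)) j = (x(1 := 0)) j"
      proof (cases "j = 1")
        case False
        then have "j \<notin> {1..d}" using assms by auto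
        then have "y j = x j" using that x(2) unfolding V_def by (metis PiE_arb)
        then show ?thesis using False by simp
      qed simp
    qed
    have "(i, y(i := 0)) \<in> lines T" if "y \<in> V" "i \<in> {1..d}" for y i
      using that(2) x(1) *[OF that(1)] assms
      unfolding in_lines_iff by (metis atLeastAtMost_singleton singletonD)
    then show ?thesis by (auto simp: full_def)
  qed
  moreover have "card V > 0" using x finite_V by (auto simp: card_gt_0_iff)
  ultimately show False using T by (auto simp: isolating_def)
qed

section \<open>Disconnected configurations\<close>

text \<open>Grow \<open>T\<close> inside \<open>W\<close> one vertex at a time, each new vertex
  contributing a new line, so that \<open>card T\<close> stays below the number of lines. A maximal
  such \<open>T\<close> meets every line that \<open>W\<close> meets.\<close>

lemma conn_set_spanning_lines:
  assumes W: "W \<subseteq> V" "W \<noteq> {}" "conn_set adj W"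
  obtains T where "T \<subseteq> W" "T \<noteq> {}" "conn_set adj T" "card T \<le> card (lines T)" "lines T = lines W"
proof -
  have finW: "finite W" using W finite_V by (auto intro: finite_subset)
  define Q where "Q = {T. T \<subseteq> W \<and> T \<noteq> {} \<and> conn_set adj T \<and> card T \<le> card (lines T)}"
  have finQ: "finite Q" unfolding Q_def by (rule finite_subset[of _ "Pow W"]) (use finW in auto)
  obtain x where "x \<in> W" using W by auto
  have "(1, x(1 := 0)) \<in> lines {x}" using d_pos by (auto simp: in_lines_iff)
  then have "card (lines {x}) \<ge> 1"
    using finite_lines[of "{x}"] by (metis Suc_leI card_gt_0_iff empty_iff finite.emptyI finite_insert One_nat_def)
  then have "{x} \<in> Q" using \<open>x \<in> W\<close> by (auto simp: Q_def conn_set_singleton)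
  then obtain T where T: "T \<in> Q" "\<And>T'. T' \<in> Q \<Longrightarrow> T \<subseteq> T' \<Longrightarrow> T = T'"
    using finite_has_maximal[OF finQ] by blast
  have TW: "T \<subseteq> W" "T \<noteq> {}" "conn_set adj T" "card T \<le> card (lines T)" using T by (auto simp: Q_def)
  have finT: "finite T" using TW finW by (auto intro: finite_subset)
  \<comment> \<open>The cut is taken along \<open>U\<close> rather than \<open>T\<close>: an arc
    leaving \<open>U\<close> ends in a vertex that has some line not yet met by
    \<open>T\<close>.\<close>
  define U where "U = {w \<in> W. lines {w} \<subseteq> lines T}"
  have TU: "T \<subseteq> U" using TW by (auto simp: U_def lines_def)
  have "U = W"
  proof (rule ccontr)
    assume "U \<noteq> W"
    then have "U \<subset> W" "U \<noteq> {}" using TU TW by (auto simp: U_def)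
    then obtain u w where uw: "u \<in> U" "w \<in> W - U" "adj u w" using conn_setD W by metis
    then obtain i where i: "i \<in> {1..d}" "u(i := 0) = w(i := 0)" by (auto simp: adj_def)
    have "(i, u(i := 0)) \<in> lines {u}" using i by (simp add: in_lines_iff)
    then have "(i, u(i := 0)) \<in> lines T" using uw by (auto simp: U_def)
    \<comment> \<open>The vertex \<open>u\<close> need not belong to \<open>T\<close>, but the line
      shared by \<open>u\<close> and \<open>w\<close> meets \<open>T\<close> in some
      \<open>t\<close>, to which \<open>w\<close> can be attached.\<close>
    then obtain t where t: "t \<in> T" "w(i := 0) = t(i := 0)" unfolding in_lines_iff i(2) by blast
    have wT: "w \<notin> T" using uw TU by auto
    then have "adj w t" using t i by (auto simp: adj_def)
    then have c: "conn_set adj (insert w T)"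
      using conn_set_insert[OF TW(3) t(1)] adj_sym by blast
    have "lines (insert w T) = lines {w} \<union> lines T" by (auto simp: lines_def)
    then have "lines T \<subset> lines (insert w T)" using uw by (auto simp: U_def)
    then have "card (lines T) < card (lines (insert w T))"
      using finT by (intro psubset_card_mono finite_lines) auto
    then have "insert w T \<in> Q" using c uw TW wT finT by (auto simp: Q_def)
    then show False using T(2)[of "insert w T"] wT by auto
  qed
  then have "lines {w} \<subseteq> lines T" if "w \<in> W" for w using that by (auto simp: U_def)
  then have "lines W \<subseteq> lines T" by (fastforce simp: lines_def)
  then have "lines T = lines W" using TW by (auto simp: lines_def)
  then show ?thesis using that TW by blast
qed

text \<open>One side of the cut makes at most half of \<open>V\<close> full. A component inside that
  side inherits this bound, and the set \<open>T\<close> spanning its lines is isolating.\<close>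

lemma disconnected_imp_isolating:
  assumes A: "A \<subseteq> V" and U: "U \<subseteq> A" "U \<noteq> {}" "U \<noteq> A"
    and cut: "\<And>u w. u \<in> U \<Longrightarrow> w \<in> A - U \<Longrightarrow> \<not> adj u w"
  obtains T where "isolating T" "T \<subseteq> A" "A \<inter> boundary T = {}"
proof -
  \<comment> \<open>The closed sets are the nonempty unions of components of
    \<open>A\<close>.\<close>
  define closed where "closed W \<longleftrightarrow> W \<subseteq> A \<and> W \<noteq> {} \<and> (\<forall>u\<in>W. \<forall>w\<in>A - W. \<not> adj u w)" for W
  have cl: "closed U" "closed (A - U)" using U cut adj_sym unfolding closed_def by blast+
  have disj: "full (lines U) \<inter> full (lines (A - U)) = {}"
  proof -
    have False if z: "z \<in> full (lines U)" "z \<in> full (lines (A - U))" for z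
    proof -
      \<comment> \<open>A vertex full for both sides would have a point of each side on its line in
        direction 1, and these two points would be adjacent across the cut.\<close>
      obtain u w where "u \<in> U" "w \<in> A - U" "z(1 := 0) = u(1 := 0)" "z(1 := 0) = w(1 := 0)"
        using z d_pos by (auto simp: full_def in_lines_iff dest!: bspec[of _ _ 1])
      then have "adj u w" using d_pos by (auto simp: adj_def intro!: bexI[of _ 1])
      then show False using cut \<open>u \<in> U\<close> \<open>w \<in> A - U\<close> by auto
    qed
    then show ?thesis by auto
  qed
  have "card (full (lines U)) + card (full (lines (A - U))) \<le> card V"
    using card_Un_disjoint[OF finite_full finite_full disj]
      card_mono[OF finite_V, of "full (lines U) \<union> full (lines (A - U))"]
    by (auto simp: full_def)
  then have "2 * card (full (lines U)) \<le> card V \<or> 2 * card (full (lines (A - U))) \<le> card V" by linarith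
  with cl obtain W0 where W0: "closed W0" "2 * card (full (lines W0)) \<le> card V" by blast
  have finA: "finite A" using A finite_V by (auto intro: finite_subset)
  \<comment> \<open>A minimal closed subset of \<open>W0\<close> is a single component;
    \<open>full\<close> is monotone, so the half bound passes to it.\<close>
  define Q where "Q = {W. closed W \<and> W \<subseteq> W0}"
  have finQ: "finite Q" by (rule finite_subset[of _ "Pow A"]) (use finA in \<open>auto simp: Q_def closed_def\<close>)
  have "W0 \<in> Q" using W0 by (auto simp: Q_def)
  then obtain W where W: "W \<in> Q" "\<And>W'. W' \<in> Q \<Longrightarrow> W' \<subseteq> W \<Longrightarrow> W = W'"
    using finite_has_minimal[OF finQ] by blast
  have clW: "closed W" and WW0: "W \<subseteq> W0" using W by (auto simp: Q_def)
  have WA: "W \<subseteq> A" "W \<noteq> {}" using clW by (auto simp: closed_def)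
  have "conn_set adj W"
    unfolding conn_set_def
  proof (intro allI impI, rule ccontr)
    fix X assume X: "X \<subset> W \<and> X \<noteq> {}" "\<not> (\<exists>u\<in>X. \<exists>w\<in>W - X. adj u w)"
    then have "closed X" using clW unfolding closed_def by blast
    then have "X \<in> Q" using X WW0 by (auto simp: Q_def)
    then show False using W(2)[of X] X by auto
  qed
  then obtain T where T: "T \<subseteq> W" "T \<noteq> {}" "conn_set adj T" "card T \<le> card (lines T)" "lines T = lines W"
    using conn_set_spanning_lines[of W] WA A by blast
  have "full (lines W) \<subseteq> full (lines W0)" using WW0 by (force simp: full_def in_lines_iff)
  then have "2 * card (full (lines T)) \<le> card V"
    using W0 card_mono[OF finite_full, of "full (lines W)" "lines W0"] T by simp
  then have "isolating T" using T WA A by (auto simp: isolating_def)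
  moreover have "A \<inter> boundary T = {}"
  proof -
    \<comment> \<open>An occupied vertex on a line meeting \<open>W\<close> belongs to the component
      \<open>W\<close> itself, and all its lines then meet \<open>W\<close>.\<close>
    have "y \<in> full (lines W)" if y: "y \<in> A" "y \<in> covered (lines W)" for y
    proof -
      obtain i w where iw: "i \<in> {1..d}" "w \<in> W" "y(i := 0) = w(i := 0)"
        using y by (auto simp: covered_def in_lines_iff)
      have "y \<in> W"
      proof (rule ccontr)
        assume "y \<notin> W"
        then have "adj w y" using iw unfolding adj_def by metis
        then show False using clW iw y \<open>y \<notin> W\<close> by (auto simp: closed_def)
      qed
      then show ?thesis using subset_full[of W] WA A by blast
    qed
    then show ?thesis using T by (auto simp: boundary_def)
  qed
  ultimately show ?thesis using that T WA by blast
qed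

lemma isolating_disjoint_boundary: "isolating T \<Longrightarrow> T \<inter> boundary T = {}"
  using subset_full by (auto simp: isolating_def boundary_def)

section \<open>A union bound over isolating sets\<close>

lemma finite_isolating: "finite {T. isolating T}"
  by (rule finite_subset[of _ "Pow V"]) (use finite_V in \<open>auto simp: isolating_def\<close>)

text \<open>Isolating sets are grouped by size and by a root vertex, and the rooted connected sets
  are counted by \<open>card_conn_sets_le\<close>. The function \<beta> leaves open which boundary
  estimate is used for each size.\<close>

lemma sum_isolating_le:
  fixes q :: real
  assumes q: "0 \<le> q" "q \<le> 1" and D: "D = (\<Sum>i=1..d. card (K i))"
    and \<beta>: "\<And>T. isolating T \<Longrightarrow> (1 - q) ^ card (boundary T) \<le> \<beta> (card T)" "\<And>t. \<beta> t \<ge> 0"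
  shows "(\<Sum>T | isolating T. q ^ card T * (1 - q) ^ card (boundary T))
           \<le> (\<Sum>t=1..card V. (real (card V) * q * exp 1) * ((real D + 1) * exp 1 * q) ^ (t - 1) * \<beta> t)"
proof -
  define Q where "Q x t = {T. T \<subseteq> V \<and> x \<in> T \<and> conn_set adj T \<and> card T = t}" for x t
  have finQ: "finite (Q x t)" for x t
    by (rule finite_subset[of _ "Pow V"]) (use finite_V in \<open>auto simp: Q_def\<close>)
  \<comment> \<open>Each \<open>T\<close> is indexed by its size and any of its points as root.
    Overcounting is harmless because the summands are nonnegative.\<close>
  have sub: "{T. isolating T} \<subseteq> (\<lambda>((t, x), T). T) ` (SIGMA (t, x) : {1..card V} \<times> V. Q x t)"
  proof
    fix T assume "T \<in> {T. isolating T}"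
    then have T: "T \<subseteq> V" "T \<noteq> {}" "conn_set adj T" by (auto simp: isolating_def)
    then obtain x where x: "x \<in> T" by auto
    have "card T \<le> card V" using T finite_V by (intro card_mono) auto
    moreover have "card T \<ge> 1" using T finite_V finite_subset[of T V] by (auto simp: Suc_le_eq card_gt_0_iff)
    ultimately show "T \<in> (\<lambda>((t, x), T). T) ` (SIGMA (t, x) : {1..card V} \<times> V. Q x t)"
      using T x by (intro image_eqI[of _ _ "((card T, x), T)"]) (auto simp: Q_def)
  qed
  have "(\<Sum>T | isolating T. q ^ card T * (1 - q) ^ card (boundary T))
      \<le> (\<Sum>T | isolating T. q ^ card T * \<beta> (card T))"
    using q \<beta> by (intro sum_mono mult_left_mono) auto
  also have "\<dots> \<le> (\<Sum>T\<in>(\<lambda>((t, x), T). T) ` (SIGMA (t, x) : {1..card V} \<times> V. Q x t). q ^ card T * \<beta> (card T))"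
    using q \<beta> finite_V finQ by (intro sum_mono2 sub finite_imageI finite_SigmaI) auto
  also have "\<dots> \<le> (\<Sum>((t, x), T)\<in>(SIGMA (t, x) : {1..card V} \<times> V. Q x t). q ^ card T * \<beta> (card T))"
    using sum_image_le[of "SIGMA (t, x) : {1..card V} \<times> V. Q x t" "\<lambda>T. q ^ card T * \<beta> (card T)"
        "\<lambda>((t, x), T). T"] q \<beta> finite_V finQ
    by (auto simp: case_prod_unfold intro!: finite_SigmaI)
  also have "\<dots> = (\<Sum>(t, x)\<in>{1..card V} \<times> V. \<Sum>T\<in>Q x t. q ^ card T * \<beta> (card T))"
    using sum.Sigma[of "{1..card V} \<times> V" "\<lambda>(t, x). Q x t" "\<lambda>_ T. q ^ card T * \<beta> (card T)"] finite_V finQ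
    by (simp add: case_prod_unfold)
  also have "\<dots> = (\<Sum>t=1..card V. \<Sum>x\<in>V. \<Sum>T\<in>Q x t. q ^ card T * \<beta> (card T))"
    by (simp add: sum.cartesian_product)
  also have "\<dots> \<le> (\<Sum>t=1..card V. \<Sum>x\<in>V. q * exp 1 * ((real D + 1) * exp 1 * q) ^ (t - 1) * \<beta> t)"
  proof (intro sum_mono)
    fix t x assume t: "t \<in> {1..card V}" and x: "x \<in> V"
    have "(\<Sum>T\<in>Q x t. q ^ card T * \<beta> (card T)) = real (card (Q x t)) * (q ^ t * \<beta> t)"
      by (simp add: Q_def)
    also have "\<dots> \<le> (real D + 1) ^ (t - 1) * exp (real t) * (q ^ t * \<beta> t)"
      using card_conn_sets_le[OF finite_V x _ degree_le, of t] t q \<beta> unfolding Q_def D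
      by (intro mult_right_mono) auto
    also have "\<dots> = q * exp 1 * ((real D + 1) * exp 1 * q) ^ (t - 1) * \<beta> t"
    proof -
      obtain s where s: "t = Suc s" using t by (cases t) auto
      have "exp (real t) = exp 1 * exp 1 ^ s" by (simp add: s exp_of_nat_mult[symmetric] exp_add[symmetric])
      then show ?thesis by (simp add: s power_mult_distrib)
    qed
    finally show "(\<Sum>T\<in>Q x t. q ^ card T * \<beta> (card T)) \<le> q * exp 1 * ((real D + 1) * exp 1 * q) ^ (t - 1) * \<beta> t" .
  qed
  also have "\<dots> = (\<Sum>t=1..card V. (real (card V) * q * exp 1) * ((real D + 1) * exp 1 * q) ^ (t - 1) * \<beta> t)"
    by (simp add: mult.assoc)
  finally show ?thesis .
qed

section \<open>Connectivity of the site subgraph\<close>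

definition graph :: "(nat \<Rightarrow> int) pair_pre_digraph" where
  "graph = \<lparr>pverts = V, parcs = {(x, y). x \<in> V \<and> y \<in> V \<and> hamming_dist d x y = 1}\<rparr>"

lemma adj_imp_hamming_dist:
  assumes "x \<in> V" "y \<in> V" "adj x y"
  shows "hamming_dist d x y = 1"
proof -
  obtain i where i: "x \<noteq> y" "i \<in> {1..d}" "x(i := 0) = y(i := 0)" using assms by (auto simp: adj_def)
  have "x i \<noteq> y i" using i by (metis fun_upd_triv fun_upd_upd)
  moreover have "x j = y j" if "j \<noteq> i" for j using fun_upd_zero_eqD[OF i(3) that] .
  ultimately have "{i \<in> {1..d}. x i \<noteq> y i} = {i}" using i(2) by auto
  then show ?thesis by (simp add: hamming_dist_def)
qed

text \<open>The vertices reachable from a fixed \<open>u\<close> form one side of a cut, to which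
  \<open>disconnected_imp_isolating\<close> applies. Nonemptiness is assumed because the empty graph
  does not count as connected.\<close>

lemma connected_site_graph:
  assumes A: "{v \<in> V. f v} \<noteq> {}"
    and no: "\<not> (\<exists>T. isolating T \<and> (\<forall>v\<in>T. f v) \<and> (\<forall>v\<in>boundary T. \<not> f v))"
  shows "connected (with_proj graph \<restriction> {v \<in> V. f v})"
proof -
  define A where "A = {v \<in> V. f v}"
  define H where "H = with_proj graph \<restriction> A"
  have verts: "verts H = A" by (simp add: H_def)
  have arcs: "(x, y) \<in> symcl (arcs_ends H)" if "x \<in> A" "y \<in> A" "adj x y" for x y
  proof -
    have "(x, y) \<in> arcs H"
      using that adj_imp_hamming_dist[of x y] by (auto simp: H_def graph_def A_def)
    then show ?thesis by (force simp: symcl_def arcs_ends_conv H_def)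
  qed
  have "(u, v) \<in> rtrancl_on A (symcl (arcs_ends H))" if u: "u \<in> A" and v: "v \<in> A" for u v
  proof (rule ccontr)
    assume nv: "(u, v) \<notin> rtrancl_on A (symcl (arcs_ends H))"
    define U where "U = {w \<in> A. (u, w) \<in> rtrancl_on A (symcl (arcs_ends H))}"
    obtain T where "isolating T" "T \<subseteq> A" "A \<inter> boundary T = {}"
    proof (rule disconnected_imp_isolating[of A U])
      show "A \<subseteq> V" by (auto simp: A_def)
      show "U \<subseteq> A" "U \<noteq> {}" "U \<noteq> A" using u v nv by (auto simp: U_def)
      show "\<not> adj y w" if "y \<in> U" "w \<in> A - U" for y w
        using that arcs[of y w] rtrancl_on_into_rtrancl_on[of u y A "symcl (arcs_ends H)" w]
        by (auto simp: U_def)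
    qed
    moreover have "boundary T \<subseteq> V" by (auto simp: boundary_def covered_def)
    ultimately have "\<forall>v\<in>T. f v" "\<forall>v\<in>boundary T. \<not> f v" unfolding A_def by blast+
    then show False using no \<open>isolating T\<close> by blast
  qed
  then show ?thesis
    using A verts unfolding connected_conv A_def[symmetric] H_def[symmetric] by auto
qed

text \<open>Union bound: failure means that all sites are vacant or that some isolating set is
  occupied with vacant boundary.\<close>

lemma prob_connected_ge:
  fixes q :: real
  assumes q: "0 \<le> q" "q \<le> 1"
  shows "measure_pmf.prob (site_subgraph (with_proj graph) q) {H. connected H}
    \<ge> 1 - (1 - q) ^ card V - (\<Sum>T | isolating T. q ^ card T * (1 - q) ^ card (boundary T))"
proof -
  let ?P = "measure_pmf.prob (site_pmf V q)"
  define C where "C = {f. connected (with_proj graph \<restriction> {v \<in> V. f v})}"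
  define ev where "ev T = {f. (\<forall>v\<in>T. f v) \<and> (\<forall>v\<in>boundary T. \<not> f v)}" for T
  define em where "em = {f. (\<forall>v\<in>{}. f v) \<and> (\<forall>v\<in>V. \<not> f v)}"
  have "UNIV - C \<subseteq> em \<union> (\<Union>T\<in>{T. isolating T}. ev T)"
  proof
    fix f assume "f \<in> UNIV - C"
    then have "{v \<in> V. f v} = {} \<or> (\<exists>T. isolating T \<and> (\<forall>v\<in>T. f v) \<and> (\<forall>v\<in>boundary T. \<not> f v))"
      using connected_site_graph[of f] unfolding C_def by blast
    then show "f \<in> em \<union> (\<Union>T\<in>{T. isolating T}. ev T)" unfolding em_def ev_def by blast
  qed
  then have "?P (UNIV - C) \<le> ?P (em \<union> (\<Union>T\<in>{T. isolating T}. ev T))"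
    by (intro measure_pmf.finite_measure_mono) auto
  also have "\<dots> \<le> ?P em + ?P (\<Union>T\<in>{T. isolating T}. ev T)"
    by (intro measure_Un_le) auto
  also have "?P (\<Union>T\<in>{T. isolating T}. ev T) \<le> (\<Sum>T | isolating T. ?P (ev T))"
    by (intro measure_pmf.finite_measure_subadditive_finite finite_isolating) auto
  also have "\<dots> = (\<Sum>T | isolating T. q ^ card T * (1 - q) ^ card (boundary T))"
    unfolding ev_def
    by (intro sum.cong refl prob_occupied_vacant finite_V q)
       (simp_all add: isolating_disjoint_boundary, auto simp: isolating_def boundary_def covered_def)
  also have "?P em = (1 - q) ^ card V"
    unfolding em_def by (subst prob_occupied_vacant) (use finite_V q in auto)
  finally have "?P (UNIV - C) \<le> (1 - q) ^ card V + (\<Sum>T | isolating T. q ^ card T * (1 - q) ^ card (boundary T))"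
    by simp
  moreover have "?P (UNIV - C) = 1 - ?P C"
    using measure_pmf.prob_compl[of C "site_pmf V q"] by simp
  moreover have "measure_pmf.prob (site_subgraph (with_proj graph) q) {H. connected H} = ?P C"
    by (simp add: site_subgraph_def measure_map_pmf C_def vimage_def graph_def)
  ultimately show ?thesis by simp
qed

end

text \<open>With \<open>x = n * q\<close>, the factor \<open>card V * q * (D * q) ^ (t - 1)\<close>
  from the count is of order \<open>n powr (d - 1) * (A * x) ^ t\<close>. The boundary contributes
  \<open>exp (- S * x)\<close> for sizes below \<open>t0\<close> and
  \<open>exp (- \<kappa> * x) ^ t\<close> from \<open>t0\<close> on.\<close>

lemma (in box) prob_connected_explicit:
  fixes q \<eta> S P :: real and n t0 :: nat
  assumes q: "0 \<le> q" "q \<le> 1" and n: "n \<ge> 1" and \<eta>: "\<eta> > 0"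
    and K_ge: "\<And>i. i \<in> {1..d} \<Longrightarrow> \<eta> * real n \<le> real (card (K i))"
    and K_sum: "S * real n - real d \<le> real (\<Sum>i=1..d. card (K i))" "real (\<Sum>i=1..d. card (K i)) \<le> S * real n"
    and V_le: "real (card V) \<le> P * real n ^ d"
  defines "\<kappa> \<equiv> \<eta> / real (d * (2 * d + 1))" and "A \<equiv> (S + 1) * exp 1" and "x \<equiv> real n * q"
  shows "measure_pmf.prob (site_subgraph (with_proj graph) q) {H. connected H}
    \<ge> 1 - exp (- \<eta> * x) - P * exp (2 * real d + real t0 ^ 2) * (real n powr (real d - 1) *
        ((\<Sum>t<t0. (A * x) ^ t * exp (- S * x)) + (\<Sum>t=t0..card V. (A * x * exp (- \<kappa> * x)) ^ t)))"
proof -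
  define D where "D = (\<Sum>i=1..d. card (K i))"
  \<comment> \<open>The exponent collects the additive losses: \<open>d\<close> from rounding in
    \<open>K_sum\<close>, and \<open>d + t0 ^ 2\<close> from \<open>boundary_sharp\<close>. They may
    be multiplied by \<open>q \<le> 1\<close>.\<close>
  define E where "E = exp (2 * real d + real t0 ^ 2)"
  define \<beta> where "\<beta> t = (if t < t0 then E * exp (- S * x) else exp (- \<kappa> * x) ^ t)" for t
  have E: "E \<ge> 1" by (simp add: E_def)
  have x: "x \<ge> 0" using q by (simp add: x_def)
  have "0 \<le> S * real n" using K_sum(2) by (rule order_trans[rotated]) (simp add: sum_nonneg)
  then have S: "S \<ge> 0" using n by (simp add: zero_le_mult_iff)
  have "0 \<le> P * real n ^ d" using V_le by (rule order_trans[rotated]) simp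
  moreover have "real n ^ d > 0" using n by simp
  ultimately have P: "P \<ge> 0" by (simp add: zero_le_mult_iff)
  have A: "A \<ge> exp 1" using S by (simp add: A_def)
  then have A0: "A \<ge> 0" using exp_ge_zero order_trans by blast
  have \<beta>_nonneg: "\<beta> t \<ge> 0" for t using E by (simp add: \<beta>_def)
  have linear: "\<kappa> * real (card T) * real n \<le> real (card (boundary T))" if T: "isolating T" for T
  proof -
    define m where "m = nat \<lceil>\<eta> * real n\<rceil>"
    have "m \<le> card (K i)" if "i \<in> {1..d}" for i
      using K_ge[OF that] by (simp add: m_def ceiling_le_iff)
    from boundary_linear[OF T this]
    have "real (card T * m) \<le> real (d * (2 * d + 1) * card (boundary T))" by (simp only: of_nat_le_iff)
    moreover have "real (card T) * (\<eta> * real n) \<le> real (card T) * real m"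
      unfolding m_def by (intro mult_left_mono) (auto simp: real_nat_ceiling_ge)
    ultimately have "real (card T) * (\<eta> * real n) \<le> real (d * (2 * d + 1)) * real (card (boundary T))"
      unfolding of_nat_mult by linarith
    moreover have "real (d * (2 * d + 1)) > 0" using d_pos by (subst of_nat_0_less_iff) auto
    ultimately show ?thesis unfolding \<kappa>_def by (simp add: pos_divide_le_eq mult_ac)
  qed
  have \<beta>: "(1 - q) ^ card (boundary T) \<le> \<beta> (card T)" if T: "isolating T" for T
  proof (cases "card T < t0")
    case True
    have "d \<noteq> 1" using not_isolating_dim1 T by blast
    then have "d \<ge> 2" using d_pos by simp
    then have "D \<le> card (boundary T) + d + card T ^ 2"
      unfolding D_def using T by (intro boundary_sharp) (auto simp: isolating_def)
    also have "\<dots> \<le> card (boundary T) + d + t0 ^ 2"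
      using True by (intro add_left_mono power_mono) auto
    finally have "real D \<le> real (card (boundary T) + d + t0 ^ 2)" by (simp only: of_nat_le_iff)
    then have *: "S * real n \<le> real (card (boundary T)) + (2 * real d + real t0 ^ 2)"
      using K_sum(1) unfolding D_def by simp
    have "q * (S * real n) \<le> q * (real (card (boundary T)) + (2 * real d + real t0 ^ 2))"
      using * q by (intro mult_left_mono) auto
    also have "\<dots> = q * real (card (boundary T)) + q * (2 * real d + real t0 ^ 2)"
      by (rule distrib_left)
    also have "\<dots> \<le> q * real (card (boundary T)) + (2 * real d + real t0 ^ 2)"
      using q by (intro add_left_mono mult_left_le_one_le) auto
    finally have "- q * real (card (boundary T)) \<le> (2 * real d + real t0 ^ 2) + - S * x"
      by (simp add: x_def mult_ac)
    then have "exp (- q * real (card (boundary T))) \<le> E * exp (- S * x)"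
      unfolding E_def exp_add[symmetric] by (simp only: exp_le_cancel_iff)
    then show ?thesis
      using power_one_minus_le_exp[OF q(2), of "card (boundary T)"] True by (simp add: \<beta>_def)
  next
    case False
    have "q * (\<kappa> * real (card T) * real n) \<le> q * real (card (boundary T))"
      using linear[OF T] q by (intro mult_left_mono) auto
    then have "exp (- q * real (card (boundary T))) \<le> exp (real (card T) * (- \<kappa> * x))"
      by (simp add: x_def mult_ac)
    also have "\<dots> = exp (- \<kappa> * x) ^ card T" by (rule exp_of_nat_mult)
    finally show ?thesis
      using power_one_minus_le_exp[OF q(2), of "card (boundary T)"] False by (simp add: \<beta>_def)
  qed
  define R where "R = P * real n powr (real d - 1)"
  have R: "R \<ge> 0" using P by (simp add: R_def)
  \<comment> \<open>One factor \<open>n\<close> is split off to combine with \<open>q\<close> into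
    \<open>x\<close>, leaving the exponent \<open>d - 1\<close> that the hypothesis on
    \<open>c\<close> has to beat.\<close>
  have n_pow: "real n ^ d = real n powr (real d - 1) * real n"
    using n d_pos by (simp add: powr_realpow[symmetric] powr_diff)
  have term_le: "(real (card V) * q * exp 1) * ((real D + 1) * exp 1 * q) ^ (t - 1) \<le> R * (A * x) ^ t"
    if "t \<ge> 1" for t
  proof -
    have "real (card V) * q * exp 1 \<le> (P * real n ^ d) * q * exp 1"
      using V_le q by (intro mult_right_mono) auto
    also have "\<dots> = R * (exp 1 * x)" by (simp add: n_pow R_def x_def)
    also have "\<dots> \<le> R * (A * x)" using A R x by (intro mult_left_mono mult_right_mono) auto
    finally have 1: "real (card V) * q * exp 1 \<le> R * (A * x)" .
    have "real D + 1 \<le> (S + 1) * real n" using K_sum(2) n by (simp add: D_def algebra_simps)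
    then have "(real D + 1) * (exp 1 * q) \<le> (S + 1) * real n * (exp 1 * q)"
      using q by (intro mult_right_mono) auto
    then have "(real D + 1) * exp 1 * q \<le> A * x" by (simp add: A_def x_def mult_ac)
    then have 2: "((real D + 1) * exp 1 * q) ^ (t - 1) \<le> (A * x) ^ (t - 1)"
      using q by (intro power_mono) auto
    have "(real (card V) * q * exp 1) * ((real D + 1) * exp 1 * q) ^ (t - 1)
        \<le> R * (A * x) * (A * x) ^ (t - 1)"
      by (rule mult_mono[OF 1 2]) (use q R A0 x in auto)
    also have "\<dots> = R * (A * x) ^ t" using that by (cases t) auto
    finally show ?thesis .
  qed
  define h1 where "h1 t = (A * x) ^ t * exp (- S * x)" for t
  define h2 where "h2 t = (A * x * exp (- \<kappa> * x)) ^ t" for t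
  have h: "h1 t \<ge> 0" "h2 t \<ge> 0" for t using A0 x by (auto simp: h1_def h2_def)
  have "(\<Sum>T | isolating T. q ^ card T * (1 - q) ^ card (boundary T))
      \<le> (\<Sum>t=1..card V. (real (card V) * q * exp 1) * ((real D + 1) * exp 1 * q) ^ (t - 1) * \<beta> t)"
    by (rule sum_isolating_le[OF q D_def \<beta> \<beta>_nonneg])
  also have "\<dots> \<le> (\<Sum>t=1..card V. R * (A * x) ^ t * \<beta> t)"
    using term_le \<beta>_nonneg by (intro sum_mono mult_right_mono) auto
  also have "\<dots> \<le> (\<Sum>t=1..card V. R * E * (if t < t0 then h1 t else h2 t))"
  proof (intro sum_mono)
    fix t
    show "R * (A * x) ^ t * \<beta> t \<le> R * E * (if t < t0 then h1 t else h2 t)"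
    proof (cases "t < t0")
      case False
      have "(A * x) ^ t * \<beta> t = h2 t" using False by (simp add: \<beta>_def h2_def power_mult_distrib)
      \<comment> \<open>Only small sizes produce \<open>E\<close>; since \<open>E \<ge> 1\<close> it
        can be inserted here as well and pulled out of the whole sum.\<close>
      also have "\<dots> \<le> E * h2 t" using E h(2)[of t] by (simp add: mult_le_cancel_right1)
      finally show ?thesis using False R by (simp add: mult.assoc mult_left_mono)
    qed (simp add: \<beta>_def h1_def)
  qed
  also have "\<dots> \<le> (\<Sum>t\<in>{..<t0} \<union> {t0..card V}. R * E * (if t < t0 then h1 t else h2 t))"
    using R E h by (intro sum_mono2) auto
  also have "\<dots> = R * E * ((\<Sum>t<t0. h1 t) + (\<Sum>t=t0..card V. h2 t))"
    by (subst sum.union_disjoint) (auto simp: sum_distrib_left[symmetric] distrib_left)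
  finally have sum_le: "(\<Sum>T | isolating T. q ^ card T * (1 - q) ^ card (boundary T))
      \<le> R * E * ((\<Sum>t<t0. h1 t) + (\<Sum>t=t0..card V. h2 t))" .
  \<comment> \<open>\<open>V\<close> contains a full line in direction 1. This makes the probability
    that every site is vacant at most \<open>exp (- \<eta> * x)\<close>.\<close>
  have "\<eta> * real n \<le> real (card V)"
  proof -
    have "K i \<noteq> {}" if "i \<in> {1..d}" for i
    proof -
      have "\<eta> * real n > 0" using \<eta> n by simp
      then have "card (K i) \<noteq> 0" using K_ge[OF that] by linarith
      then show ?thesis by auto
    qed
    then have "V \<noteq> {}" by (simp add: V_def PiE_eq_empty_iff)
    then obtain y where y: "y \<in> V" by auto
    have "card (K 1) \<le> card V"
    proof (rule card_inj_on_le[OF _ _ finite_V])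
      show "inj_on (\<lambda>k. y(1 := k)) (K 1)" by (auto simp: inj_on_def dest: fun_cong[of _ _ 1])
      show "(\<lambda>k. y(1 := k)) ` K 1 \<subseteq> V" using y fun_upd_in_V d_pos by auto
    qed
    then show ?thesis using K_ge[of 1] d_pos by simp
  qed
  then have "q * (\<eta> * real n) \<le> q * real (card V)" using q by (intro mult_left_mono) auto
  then have "exp (- q * real (card V)) \<le> exp (- \<eta> * x)" by (simp add: x_def mult_ac)
  then have "(1 - q) ^ card V \<le> exp (- \<eta> * x)"
    using power_one_minus_le_exp[OF q(2), of "card V"] by linarith
  with prob_connected_ge[OF q] sum_le
  have "measure_pmf.prob (site_subgraph (with_proj graph) q) {H. connected H}
    \<ge> 1 - exp (- \<eta> * x) - R * E * ((\<Sum>t<t0. h1 t) + (\<Sum>t=t0..card V. h2 t))" by linarith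
  then show ?thesis
    unfolding R_def E_def h1_def h2_def by (simp only: mult_ac)
qed

section \<open>Asymptotics\<close>

text \<open>A single term of the exponential series is at most its sum. This absorbs powers of
  \<open>x\<close> into an exponential of arbitrarily small rate.\<close>

lemma power_le_fact_exp:
  fixes A x \<delta> :: real
  assumes "0 \<le> A" "0 \<le> x" "\<delta> > 0"
  shows "(A * x) ^ t \<le> fact t * (A / \<delta>) ^ t * exp (\<delta> * x)"
proof -
  have "(\<delta> * x) ^ t / fact t \<le> exp (\<delta> * x)"
  proof -
    have "(\<Sum>k\<in>{t}. (\<delta> * x) ^ k / fact k) \<le> (\<Sum>k. (\<delta> * x) ^ k / fact k)"
      using summable_exp[of "\<delta> * x"] assms
      by (intro sum_le_suminf) (auto simp: divide_inverse mult.commute)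
    then show ?thesis by (simp add: exp_def divide_inverse mult.commute scaleR_conv_of_real)
  qed
  then have "(\<delta> * x) ^ t \<le> fact t * exp (\<delta> * x)" by (simp add: field_simps)
  then have "(A / \<delta>) ^ t * (\<delta> * x) ^ t \<le> (A / \<delta>) ^ t * (fact t * exp (\<delta> * x))"
    using assms by (intro mult_left_mono) auto
  moreover have "(A / \<delta>) ^ t * (\<delta> * x) ^ t = (A * x) ^ t"
    using assms by (simp add: power_mult_distrib[symmetric])
  ultimately show ?thesis by (simp add: mult_ac)
qed

lemma exp_le_powr:
  assumes "b \<ge> 0" "n \<ge> 1" "x \<ge> c * ln (real n)"
  shows "exp (- b * x) \<le> real n powr (- b * c)"
proof -
  have "b * (c * ln (real n)) \<le> b * x" using assms by (intro mult_left_mono) auto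
  then show ?thesis using assms by (simp add: powr_def mult_ac)
qed

lemma geometric_tail_le:
  fixes r :: real
  assumes "0 \<le> r" "r \<le> 1/2"
  shows "(\<Sum>t=t0..N. r ^ t) \<le> 2 * r ^ t0"
proof -
  have "(\<Sum>t=t0..N. r ^ t) \<le> (\<Sum>t. r ^ (t + t0))"
  proof (cases "t0 \<le> N")
    case True
    have "(\<Sum>t=t0..N. r ^ t) = (\<Sum>t\<in>{0..N - t0}. r ^ (t + t0))"
      using True sum.shift_bounds_cl_nat_ivl[of "\<lambda>t. r ^ t" 0 t0 "N - t0"] by simp
    also have "\<dots> \<le> (\<Sum>t. r ^ (t + t0))"
      using assms by (intro sum_le_suminf) (auto simp: power_add intro!: summable_mult2 summable_geometric)
    finally show ?thesis .
  qed (use assms in \<open>auto intro!: suminf_nonneg simp: power_add intro!: summable_mult2 summable_geometric\<close>)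
  also have "\<dots> = r ^ t0 * (1 / (1 - r))"
    using assms by (simp add: power_add suminf_mult2[symmetric] summable_geometric suminf_geometric)
  also have "\<dots> \<le> r ^ t0 * 2" using assms by (intro mult_left_mono) (auto simp: field_simps)
  finally show ?thesis by simp
qed

text \<open>Clusters of bounded size t are governed by the sharp rate S, all larger ones by the
  crude rate \<open>\<kappa> t\<close>, which wins once \<open>t\<^sub>0\<close> is large.\<close>

lemma cluster_sum_tendsto_0:
  fixes x :: "nat \<Rightarrow> real" and A S c \<kappa> e :: real
  assumes "A > 0" "\<kappa> > 0" "c > 0" "S * c > e" "e \<ge> 0"
    and x: "eventually (\<lambda>n. x n \<ge> c * ln (real n)) sequentially"
  obtains t0 where
    "(\<lambda>n. real n powr e * ((\<Sum>t<t0. (A * x n) ^ t * exp (- S * x n))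
        + (\<Sum>t=t0..N n. (A * x n * exp (- \<kappa> * x n)) ^ t))) \<longlonglongrightarrow> 0"
proof -
  \<comment> \<open>Half the gap between \<open>S\<close> and \<open>e / c\<close>, so the reduced
    rate \<open>S - \<delta>\<close> still satisfies the strict inequality.\<close>
  define \<delta> where "\<delta> = (S - e / c) / 2"
  have \<delta>: "\<delta> > 0" using assms by (simp add: \<delta>_def field_simps)
  have \<delta>2: "(S - \<delta>) * c > e" using assms by (simp add: \<delta>_def field_simps)
  have S\<delta>: "S - \<delta> \<ge> 0"
  proof (rule ccontr)
    assume "\<not> ?thesis"
    then have "(S - \<delta>) * c < 0" using assms by (intro mult_neg_pos) auto
    then show False using \<delta>2 assms by simp
  qed
  \<comment> \<open>Chosen so that \<open>t0\<close> factors
    \<open>n powr (- (\<kappa> / 2) * c)\<close> outweigh \<open>n powr e\<close>.\<close>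
  obtain t0 :: nat where t0: "real t0 > 2 * e / (\<kappa> * c)" using reals_Archimedean2 by blast
  have t0': "e - \<kappa> / 2 * c * real t0 < 0" using t0 assms by (simp add: field_simps)
  define C1 where "C1 = (\<Sum>t<t0. fact t * (A / \<delta>) ^ t)"
  \<comment> \<open>Bounds the ratio of the tail: half of the rate \<kappa> is spent on absorbing
    the factor \<open>x n\<close>.\<close>
  define r where "r n = 2 * A / \<kappa> * real n powr (- (\<kappa> / 2) * c)" for n :: nat
  have tend: "(\<lambda>n::nat. real n powr s) \<longlonglongrightarrow> 0" if "s < 0" for s
    using tendsto_neg_powr[OF that filterlim_real_sequentially] .
  have "r \<longlonglongrightarrow> 2 * A / \<kappa> * 0" unfolding r_def
    using assms by (intro tendsto_intros tend) (auto intro: mult_pos_pos)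
  then have r_half: "eventually (\<lambda>n. r n < 1/2) sequentially"
    by (intro order_tendstoD) auto
  define g where "g n = C1 * real n powr (e - (S - \<delta>) * c)
      + 2 * (2 * A / \<kappa>) ^ t0 * real n powr (e - \<kappa> / 2 * c * real t0)" for n :: nat
  have g: "g \<longlonglongrightarrow> C1 * 0 + 2 * (2 * A / \<kappa>) ^ t0 * 0" unfolding g_def
    using \<delta>2 t0' by (intro tendsto_intros tend) auto
  define f where "f n = real n powr e * ((\<Sum>t<t0. (A * x n) ^ t * exp (- S * x n))
        + (\<Sum>t=t0..N n. (A * x n * exp (- \<kappa> * x n)) ^ t))" for n
  have bound: "eventually (\<lambda>n. 0 \<le> f n \<and> f n \<le> g n) sequentially"
    using x r_half eventually_ge_at_top[of 1]
  proof eventually_elim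
    case (elim n)
    have x0: "x n \<ge> 0"
    proof -
      have "c * ln (real n) \<ge> 0" using assms elim by simp
      then show ?thesis using elim by linarith
    qed
    have r0: "r n \<ge> 0" using assms by (simp add: r_def)
    \<comment> \<open>Only a lower bound on \<open>x n\<close> is available, so powers of
      \<open>x n\<close> are absorbed first; the remaining exponential is decreasing and the lower
      bound can be inserted.\<close>
    have "(\<Sum>t<t0. (A * x n) ^ t * exp (- S * x n)) \<le> (\<Sum>t<t0. fact t * (A / \<delta>) ^ t * exp (\<delta> * x n) * exp (- S * x n))"
      using power_le_fact_exp[of A "x n" \<delta>] assms x0 \<delta> by (intro sum_mono mult_right_mono) auto
    also have "\<dots> = C1 * exp (- (S - \<delta>) * x n)"
      unfolding C1_def sum_distrib_right
      by (intro sum.cong refl) (simp add: mult.assoc exp_add[symmetric] algebra_simps)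
    also have "\<dots> \<le> C1 * real n powr (- (S - \<delta>) * c)"
      using S\<delta> elim assms \<delta> by (intro mult_left_mono exp_le_powr) (auto simp: C1_def intro!: sum_nonneg)
    finally have 1: "(\<Sum>t<t0. (A * x n) ^ t * exp (- S * x n)) \<le> C1 * real n powr (- (S - \<delta>) * c)" .
    have "A * x n * exp (- \<kappa> * x n) \<le> (A / (\<kappa> / 2)) * exp (\<kappa> / 2 * x n) * exp (- \<kappa> * x n)"
      using power_le_fact_exp[of A "x n" "\<kappa> / 2" 1] assms x0 by (intro mult_right_mono) auto
    also have "\<dots> = 2 * A / \<kappa> * exp (- (\<kappa> / 2) * x n)"
      by (simp add: mult.assoc exp_add[symmetric] algebra_simps)
    also have "\<dots> \<le> r n" unfolding r_def using assms elim
      by (intro mult_left_mono exp_le_powr) auto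
    finally have *: "A * x n * exp (- \<kappa> * x n) \<le> r n" .
    have "(\<Sum>t=t0..N n. (A * x n * exp (- \<kappa> * x n)) ^ t) \<le> (\<Sum>t=t0..N n. r n ^ t)"
      using assms x0 by (intro sum_mono power_mono *) auto
    also have "\<dots> \<le> 2 * r n ^ t0" using r0 elim by (intro geometric_tail_le) auto
    also have "\<dots> = 2 * (2 * A / \<kappa>) ^ t0 * real n powr (- (\<kappa> / 2 * c * real t0))"
    proof -
      have "(real n powr (- (\<kappa> / 2) * c)) ^ t0 = real n powr (- (\<kappa> / 2 * c * real t0))"
        using elim by (subst powr_power) (auto simp: mult_ac)
      then show ?thesis by (simp only: r_def power_mult_distrib mult.assoc)
    qed
    finally have 2: "(\<Sum>t=t0..N n. (A * x n * exp (- \<kappa> * x n)) ^ t)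
        \<le> 2 * (2 * A / \<kappa>) ^ t0 * real n powr (- (\<kappa> / 2 * c * real t0))" .
    have "f n \<le> real n powr e * (C1 * real n powr (- (S - \<delta>) * c)
        + 2 * (2 * A / \<kappa>) ^ t0 * real n powr (- (\<kappa> / 2 * c * real t0)))"
      unfolding f_def using 1 2 by (intro mult_left_mono add_mono) auto
    also have "\<dots> = g n"
    proof -
      have "real n powr e * real n powr (- u) = real n powr (e - u)" for u
        by (metis powr_add add_uminus_conv_diff)
      then show ?thesis
        unfolding g_def by (simp only: distrib_left mult.left_commute[of "real n powr e"] mult_minus_left)
    qed
    finally have "f n \<le> g n" .
    moreover have "f n \<ge> 0" unfolding f_def
      using assms x0 by (intro mult_nonneg_nonneg add_nonneg_nonneg sum_nonneg) auto
    ultimately show ?case by simp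
  qed
  have "f \<longlonglongrightarrow> 0"
    by (rule tendsto_sandwich[of "\<lambda>_. 0" f sequentially g])
       (use bound g in \<open>auto elim: eventually_mono\<close>)
  then show ?thesis using that unfolding f_def by blast
qed

theorem theorem1p5:
  fixes d :: nat and a :: "nat \<Rightarrow> real" and c :: real and p :: "nat \<Rightarrow> real"
  assumes "d \<ge> 1"
    and "\<And>i. i \<in> {1..d} \<Longrightarrow> a i > 0"
    and "c > (real d - 1) / (\<Sum>i=1..d. a i)"
    and "\<And>n. p n \<in> {0..1}"
    and "eventually (\<lambda>n. p n \<ge> c * ln (real n) / real n) sequentially"
  shows "(\<lambda>n. measure_pmf.prob (site_subgraph (with_proj (hamming_torus d a n)) (p n))
            {H. connected H}) \<longlonglongrightarrow> 1"
proof -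
  define S where "S = (\<Sum>i=1..d. a i)"
  define P where "P = (\<Prod>i=1..d. a i)"
  \<comment> \<open>Half of the smallest \<open>a i\<close>: the other half pays for rounding side
    lengths down once \<open>\<eta> * n \<ge> 1\<close>.\<close>
  define \<eta> where "\<eta> = Min (a ` {1..d}) / 2"
  define \<kappa> where "\<kappa> = \<eta> / real (d * (2 * d + 1))"
  define A where "A = (S + 1) * exp 1"
  define x where "x n = real n * p n" for n
  define K where "K n i = {k::int. 1 \<le> k \<and> real_of_int k \<le> a i * real n}" for n i
  define N where "N n = card (box.V d (K n))" for n
  have a: "a i > 0" if "i \<in> {1..d}" for i using assms that by auto
  have ne: "{1..d} \<noteq> {}" using assms(1) by auto
  have S: "S > 0" unfolding S_def using a ne by (intro sum_pos) auto
  have c: "c > 0"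
  proof -
    have "(real d - 1) / S \<ge> 0" using assms(1) S by (intro divide_nonneg_pos) auto
    then show ?thesis using assms(3) unfolding S_def by linarith
  qed
  have Sc: "S * c > real d - 1"
    using assms(3) S unfolding S_def[symmetric] by (simp add: pos_divide_less_eq mult.commute)
  have \<eta>: "\<eta> > 0" unfolding \<eta>_def using a ne by (auto simp: Min_gr_iff)
  have \<kappa>: "\<kappa> > 0"
  proof -
    have "real (d * (2 * d + 1)) > 0" using assms(1) by (subst of_nat_0_less_iff) auto
    then show ?thesis using \<eta> unfolding \<kappa>_def by simp
  qed
  have A: "A > 0" using S by (simp add: A_def)
  have K_eq: "K n i = {1..\<lfloor>a i * real n\<rfloor>}" for n i by (auto simp: K_def le_floor_iff)
  have card_K: "real (card (K n i)) = real_of_int \<lfloor>a i * real n\<rfloor>" if "i \<in> {1..d}" for n i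
    using a[OF that] by (simp add: K_eq)
  have box: "box d (K n)" for n
    by standard (use assms(1) in \<open>auto simp: K_eq\<close>)
  have graph: "box.graph d (K n) = hamming_torus d a n" for n
  proof -
    have *: "K n = (\<lambda>i. {k::int. 1 \<le> k \<and> real_of_int k \<le> a i * real n})"
      by (simp add: K_def fun_eq_iff)
    show ?thesis
      unfolding box.graph_def[OF box] box.V_def[OF box]
      unfolding hamming_torus_def torus_verts_def * ..
  qed
  have x_ge: "eventually (\<lambda>n. x n \<ge> c * ln (real n)) sequentially"
    using assms(5) eventually_gt_at_top[of 0]
    by eventually_elim (simp add: x_def field_simps)
  obtain t0 where t0: "(\<lambda>n. real n powr (real d - 1) * ((\<Sum>t<t0. (A * x n) ^ t * exp (- S * x n))
        + (\<Sum>t=t0..N n. (A * x n * exp (- \<kappa> * x n)) ^ t))) \<longlonglongrightarrow> 0"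
    \<comment> \<open>Taken with \<open>e = d - 1\<close>; \<open>Sc\<close> is exactly the
      hypothesis on \<open>c\<close>.\<close>
    using cluster_sum_tendsto_0[OF A \<kappa> c Sc _ x_ge] assms(1) by auto
  define g where "g n = 1 - exp (- \<eta> * x n) - P * exp (2 * real d + real t0 ^ 2) *
      (real n powr (real d - 1) * ((\<Sum>t<t0. (A * x n) ^ t * exp (- S * x n))
        + (\<Sum>t=t0..N n. (A * x n * exp (- \<kappa> * x n)) ^ t)))" for n
  have "(\<lambda>n. exp (- \<eta> * x n)) \<longlonglongrightarrow> 0"
  proof (rule tendsto_sandwich[where f = "\<lambda>_. 0" and h = "\<lambda>n. real n powr (- \<eta> * c)"])
    show "eventually (\<lambda>n. exp (- \<eta> * x n) \<le> real n powr (- \<eta> * c)) sequentially"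
      using x_ge eventually_ge_at_top[of 1]
      by eventually_elim (rule exp_le_powr, use \<eta> in auto)
    show "(\<lambda>n. real n powr (- \<eta> * c)) \<longlonglongrightarrow> 0"
      using \<eta> c by (intro tendsto_neg_powr filterlim_real_sequentially) auto
  qed auto
  then have "g \<longlonglongrightarrow> 1 - 0 - P * exp (2 * real d + real t0 ^ 2) * 0"
    unfolding g_def by (intro tendsto_intros t0)
  then have g: "g \<longlonglongrightarrow> 1" by simp
  have bound: "g n \<le> measure_pmf.prob (site_subgraph (with_proj (hamming_torus d a n)) (p n)) {H. connected H}"
    if n: "n \<ge> 1" "\<eta> * real n \<ge> 1" for n
  proof -
    interpret box d "K n" by (rule box)
    have "g n \<le> measure_pmf.prob (site_subgraph (with_proj graph) (p n)) {H. connected H}"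
      unfolding g_def \<kappa>_def A_def x_def N_def
    proof (rule prob_connected_explicit)
      show "0 \<le> p n" "p n \<le> 1" using assms(4)[of n] by auto
      show "n \<ge> 1" "\<eta> > 0" by fact+
      show "\<eta> * real n \<le> real (card (K n i))" if i: "i \<in> {1..d}" for i
      proof -
        have "2 * \<eta> \<le> a i" using i by (simp add: \<eta>_def)
        then have "2 * \<eta> * real n \<le> a i * real n" by (intro mult_right_mono) auto
        then show ?thesis using card_K[OF i, of n] n by linarith
      qed
      \<comment> \<open>Rounding loses less than 1 in each of the \<open>d\<close>
        directions.\<close>
      have "S * real n - real d = (\<Sum>i=1..d. a i * real n - 1)"
        by (simp add: S_def sum_subtractf sum_distrib_right)
      also have "\<dots> \<le> (\<Sum>i=1..d. real (card (K n i)))"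
        by (intro sum_mono) (use card_K in \<open>simp; linarith\<close>)
      finally show "S * real n - real d \<le> real (\<Sum>i=1..d. card (K n i))" by simp
      have "(\<Sum>i=1..d. real (card (K n i))) \<le> (\<Sum>i=1..d. a i * real n)"
        by (intro sum_mono) (use card_K in simp)
      then show "real (\<Sum>i=1..d. card (K n i)) \<le> S * real n"
        by (simp add: S_def sum_distrib_right)
      have "real (card V) = (\<Prod>i=1..d. real (card (K n i)))"
        unfolding V_def by (subst card_PiE) auto
      also have "\<dots> \<le> (\<Prod>i=1..d. a i * real n)"
        by (intro prod_mono conjI) (use card_K a in \<open>simp_all add: less_imp_le\<close>)
      also have "\<dots> = P * real n ^ d" by (simp add: P_def prod.distrib)
      finally show "real (card V) \<le> P * real n ^ d" .
    qed
    then show ?thesis unfolding graph .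
  qed
  have "eventually (\<lambda>n. real n \<ge> 1 / \<eta>) sequentially"
    using filterlim_real_sequentially by (rule filterlim_at_top[THEN iffD1, rule_format])
  then have "eventually (\<lambda>n. g n \<le> measure_pmf.prob (site_subgraph (with_proj (hamming_torus d a n)) (p n))
      {H. connected H}) sequentially"
    using eventually_ge_at_top[of 1]
  proof eventually_elim
    case (elim n)
    then have "\<eta> * real n \<ge> 1" using \<eta> by (simp add: pos_divide_le_eq mult.commute)
    with elim show ?case by (intro bound) auto
  qed
  then show ?thesis
    by (rule tendsto_sandwich[OF _ _ g tendsto_const]) auto
qed

end
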